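(* (a) There is no absolute constant $A>0$ such that $$v_p^{(2)}(f)\le A\left[\frac1pK_p(f)+\frac1{p^2}I_p(f)\right]$$ holds for all $p>2$ and all continuous functions $f\in L^p([0,1]^2)$ with $I_p(f)<\infty$. (b) For each $1<p<\infty$ let $\alpha_p,\beta_p\ge0$ be numbers with $\alpha_p\le1/p$ and $\beta_p\le1/p^2$, and suppose that there is an absolute constant $A>0$ such that $$v_p^{(2)}(f)\le A\left[\omega(f;1,1)_p+\alpha_pK_p(f)+\beta_pI_p(f)\right]$$ holds for all $1<p<\infty$ and all continuous functions $f\in L^p([0,1]^2)$ with $I_p(f)<\infty$. Then $$\liminf_{p\to\infty}p\,\alpha_p>0\quad\text{and}\quad\liminf_{p\to\infty}p^2\beta_p>0.$$
   Context: Functions are real-valued. $L^p([0,1]^2)$ is the class of measurable functions $f$ on $\mathbb{R}^2$ that are 1-periodic in each variable with $\|f\|_p=(\int_{[0,1]^2}|f|^p)^{1/p}<\infty$. For $s,t\in\mathbb{R}$, $\Delta(s,t)f(x,y)=f(x+s,y+t)-f(x+s,y)-f(x,y+t)+f(x,y)$, and $\omega(f;u,v)_p=\sup_{0\le s\le u,\,0\le t\le v}\|\Delta(s,t)f\|_p$. Set $$K_p(f)=\int_0^1t^{-1/p}[\omega(f;t,1)_p+\omega(f;1,t)_p]\frac{dt}{t},\qquad I_p(f)=\int_0^1\int_0^1(uv)^{-1/p}\omega(f;u,v)_p\frac{du}{u}\frac{dv}{v}.$$ For a function $f(x,y)$ on $\mathbb{R}^2$, 1-periodic in both variables, $$v_p^{(2)}(f)=\sup_{\mathcal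 N}\Big(\sum_{i=0}^{m-1}\sum_{j=0}^{n-1}|f(x_{i+1},y_{j+1})-f(x_{i+1},y_j)-f(x_i,y_{j+1})+f(x_i,y_j)|^p\Big)^{1/p},$$ the supremum over all nets $\mathcal N=\{(x_i,y_j):0\le i\le m,\,0\le j\le n\}$ with $x_0<x_1<\dots<x_m=x_0+1$ and $y_0<y_1<\dots<y_n=y_0+1$. "Absolute constant" means independent of $p$ and $f$. *)

theory Defs
  imports "HOL-Analysis.Analysis"
begin

text \<open>
  All norms, moduli, integrals and variations take values in \<^typ>\<open>ennreal\<close>,
  so that an infinite value is represented as such. The exponent \<open>p\<close> is a positive real number.
\<close>

definition periodic1 :: "(real \<times> real \<Rightarrow> real) \<Rightarrow> bool" where
  "periodic1 f \<longleftrightarrow> (\<forall>x y. f (x + 1, y) = f (x, y) \<and> f (x, y + 1) = f (x, y))"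

text \<open>\<open>a\<^sup>1\<^sup>/\<^sup>p\<close> for \<open>a \<in> [0,\<infinity>]\<close>.\<close>

definition ennreal_proot :: "real \<Rightarrow> ennreal \<Rightarrow> ennreal" where
  "ennreal_proot p a = (if a = \<infinity> then \<infinity> else ennreal (enn2real a powr (1 / p)))"

definition Lp_norm :: "real \<Rightarrow> (real \<times> real \<Rightarrow> real) \<Rightarrow> ennreal" where
  "Lp_norm p f =
     ennreal_proot p (\<integral>\<^sup>+ z \<in> {0..1} \<times> {0..1}. ennreal (\<bar>f z\<bar> powr p) \<partial>lebesgue)"

definition Lp_class :: "real \<Rightarrow> (real \<times> real \<Rightarrow> real) set" where
  "Lp_class p = {f. f \<in> borel_measurable lebesgue \<and> periodic1 f \<and> Lp_norm p f < \<infinity>}"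

definition mixed_diff :: "real \<Rightarrow> real \<Rightarrow> (real \<times> real \<Rightarrow> real) \<Rightarrow> real \<times> real \<Rightarrow> real" where
  "mixed_diff s t f = (\<lambda>(x, y). f (x + s, y + t) - f (x + s, y) - f (x, y + t) + f (x, y))"

definition mixed_modulus :: "real \<Rightarrow> (real \<times> real \<Rightarrow> real) \<Rightarrow> real \<Rightarrow> real \<Rightarrow> ennreal" where
  "mixed_modulus p f u v = (SUP s \<in> {0..u}. SUP t \<in> {0..v}. Lp_norm p (mixed_diff s t f))"

definition K_fun :: "real \<Rightarrow> (real \<times> real \<Rightarrow> real) \<Rightarrow> ennreal" where
  "K_fun p f =
     (\<integral>\<^sup>+ t \<in> {0<..<1}. ennreal (t powr (- 1 / p) / t) *
        (mixed_modulus p f t 1 + mixed_modulus p f 1 t) \<partial>lborel)"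

definition I_fun :: "real \<Rightarrow> (real \<times> real \<Rightarrow> real) \<Rightarrow> ennreal" where
  "I_fun p f =
     (\<integral>\<^sup>+ v \<in> {0<..<1}. (\<integral>\<^sup>+ u \<in> {0<..<1}.
        ennreal ((u * v) powr (- 1 / p) / (u * v)) * mixed_modulus p f u v \<partial>lborel) \<partial>lborel)"

text \<open>
  The axes of a net are the restrictions of \<open>x\<close> to \<open>{0..m}\<close> and of \<open>y\<close> to \<open>{0..n}\<close>;
  the condition \<open>x m = x 0 + 1\<close> forces \<open>m \<ge> 1\<close>.
\<close>

definition partition1 :: "nat \<Rightarrow> (nat \<Rightarrow> real) \<Rightarrow> bool" where
  "partition1 m x \<longleftrightarrow> (\<forall>i<m. x i < x (Suc i)) \<and> x m = x 0 + 1"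

definition vp2 :: "real \<Rightarrow> (real \<times> real \<Rightarrow> real) \<Rightarrow> ennreal" where
  "vp2 p f = Sup {ennreal ((\<Sum>i<m. \<Sum>j<n.
       \<bar>f (x (Suc i), y (Suc j)) - f (x (Suc i), y j) - f (x i, y (Suc j)) + f (x i, y j)\<bar> powr p)
         powr (1 / p)) | m n x y. partition1 m x \<and> partition1 n y}"

end

theory Submission
  imports Defs
begin

text \<open>
  All three assertions are refuted or extracted from one family of products
  \<open>f(x, y) = g(x) h(y)\<close> of 1-periodic tents of height 1, with bases of length \<open>a\<^sup>p\<close> and
  \<open>b\<^sup>p\<close> for \<open>a, b \<in> (0,1]\<close>.
  Mixed differences factor, so that \<open>v\<^sub>p\<^sup>(\<^sup>2\<^sup>)(f) \<ge> 1\<close> whatever \<open>a\<close> and \<open>b\<close> are, while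
  the one-dimensional modulus of a tent is at most a constant times
  \<open>w\<^sub>a(t) = a min(1, t / a\<^sup>p)\<close>: the increments are at most 2 and Lipschitz, and they live on a set
  of measure comparable to \<open>a\<^sup>p\<close>, whose \<open>p\<close>-th root is \<open>a\<close>.
  The weighted integral of \<open>w\<^sub>a\<close> against \<open>t\<^bsup>-1/p\<^esup> dt/t\<close> is at most
  \<open>k\<^sub>a = 2 + p(1 - a)\<close>, as \<open>weighted_int_tent_modulus_le\<close> shows. It stays bounded for \<open>a = 1\<close> and
  is of order \<open>p\<close> as soon as \<open>a\<close> is a fixed number below 1; this dichotomy drives everything.
  Up to one absolute constant,
  \<open>\<omega>(f;1,1) \<le> ab\<close>, \<open>K\<^sub>p(f) \<le> k\<^sub>a b + a k\<^sub>b\<close> and \<open>I\<^sub>p(f) \<le> k\<^sub>a k\<^sub>b\<close>,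
  and \<open>tent2_estimate\<close> inserts this into a supposed upper bound for the variation.

  For (a), \<open>a = b = 1\<close> keeps \<open>K\<^sub>p\<close> and \<open>I\<^sub>p\<close> bounded, and the factors \<open>1/p\<close> and \<open>1/p\<^sup>2\<close> push
  the right-hand side below 1 for large \<open>p\<close>.
  For the coefficient \<open>\<alpha>\<^sub>p\<close> in (b), \<open>b = 1\<close> and a fixed small \<open>a\<close> make the modulus term small,
  and \<open>\<beta>\<^sub>p I\<^sub>p\<close> is \<open>O(1/p)\<close>, so that \<open>\<alpha>\<^sub>p K\<^sub>p = O(p \<alpha>\<^sub>p)\<close> has to be bounded below.
  For \<open>\<beta>\<^sub>p\<close>, a fixed small \<open>a = b\<close> makes both the modulus term and \<open>\<alpha>\<^sub>p K\<^sub>p = O(a)\<close> small, and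
  \<open>\<beta>\<^sub>p I\<^sub>p = O(p\<^sup>2 \<beta>\<^sub>p)\<close> remains.
\<close>

section \<open>Periodic tent functions\<close>

definition tent :: "real \<Rightarrow> real \<Rightarrow> real" where
  "tent d x = max 0 (1 - 2 * infdist x \<int> / d)"

lemma infdist_Ints_attained:
  obtains k :: int where "infdist (x::real) \<int> = \<bar>x - of_int k\<bar>"
proof -
  have ne: "(\<int> :: real set) \<noteq> {}" using Ints_0 by blast
  obtain n where n: "n \<in> \<int>" "infdist x \<int> = dist x n"
    by (rule infdist_attains_inf[OF closed_Ints ne])
  from n(1) obtain k where k: "n = of_int k" by (rule Ints_cases)
  show thesis by (rule that[of k]) (simp add: n(2) k dist_real_def)
qed

lemma infdist_Ints_add_1: "infdist (x + 1) \<int> = infdist (x::real) \<int>"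
proof -
  have *: "infdist (y + of_int c) \<int> \<le> infdist y \<int>" for y :: real and c :: int
  proof -
    obtain k :: int where k: "infdist y \<int> = \<bar>y - of_int k\<bar>" by (rule infdist_Ints_attained)
    have "infdist (y + of_int c) \<int> \<le> dist (y + of_int c) (of_int (k + c))"
      by (rule infdist_le) (rule Ints_of_int)
    also have "\<dots> = \<bar>y - of_int k\<bar>" by (simp add: dist_real_def)
    finally show ?thesis by (simp add: k)
  qed
  show ?thesis using *[of x 1] *[of "x + 1" "-1"] by simp
qed

lemma infdist_Ints_0: "infdist (0::real) \<int> = 0"
  by (intro infdist_zero) auto

lemma infdist_Ints_half: "infdist (1/2::real) \<int> \<ge> 1/2"
proof -
  obtain k :: int where k: "infdist (1/2::real) \<int> = \<bar>1/2 - of_int k\<bar>"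
    by (rule infdist_Ints_attained)
  have "k \<le> 0 \<or> k \<ge> 1" by linarith
  then have "real_of_int k \<le> 0 \<or> real_of_int k \<ge> 1" by auto
  then show ?thesis unfolding k by linarith
qed

lemma tent_add_1: "tent d (x + 1) = tent d x"
  by (simp add: tent_def infdist_Ints_add_1)

lemma tent_0: "tent d 0 = 1"
  by (simp add: tent_def infdist_Ints_0)

lemma tent_1: "tent d 1 = 1"
  using tent_add_1[of d 0] by (simp add: tent_0)

lemma tent_half:
  assumes "0 < d" "d \<le> 1" shows "tent d (1/2) = 0"
proof -
  have "d \<le> 2 * infdist (1/2::real) \<int>" using infdist_Ints_half assms by linarith
  then show ?thesis using assms by (simp add: tent_def max_def field_simps)
qed

lemma tent_bounds: "0 < d \<Longrightarrow> 0 \<le> tent d x" "0 < d \<Longrightarrow> tent d x \<le> 1"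
  by (simp_all add: tent_def infdist_nonneg)

lemma continuous_on_tent: "continuous_on S f \<Longrightarrow> continuous_on S (\<lambda>x. tent d (f x))"
  unfolding tent_def divide_inverse by (intro continuous_intros)

lemma tent_increment_le:
  assumes "0 < d" "0 \<le> s"
  shows "\<bar>tent d (x + s) - tent d x\<bar> \<le> 2 * min 1 (s / d)"
proof -
  have L: "infdist (x + s) \<int> - infdist x \<int> \<le> s" "infdist x \<int> - infdist (x + s) \<int> \<le> s"
    using infdist_triangle[of "x + s" \<int> x] infdist_triangle[of x \<int> "x + s"] assms
    by (auto simp: dist_real_def)
  have lip: "\<bar>max 0 (1 - v) - max 0 (1 - w)\<bar> \<le> c" if "v \<le> w + c" "w \<le> v + c" for v w c :: real
    using that by linarith
  have "\<bar>tent d (x + s) - tent d x\<bar> \<le> 2 * s / d"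
    unfolding tent_def
    by (rule lip; unfold add_divide_distrib[symmetric]; rule divide_right_mono) (use L assms in auto)
  then have "\<bar>tent d (x + s) - tent d x\<bar> \<le> 2 * (s / d)" by simp
  moreover have "\<bar>tent d (x + s) - tent d x\<bar> \<le> 2"
    using tent_bounds[OF assms(1), of x] tent_bounds[OF assms(1), of "x + s"] by linarith
  ultimately show ?thesis by simp
qed

text \<open>
  For \<open>d \<le> 1\<close>, a set that contains all \<open>x \<in> [0,1]\<close> at which the increment \<open>tent d (x + s) - tent d x\<close> can be
  non-zero. A translate by \<open>s \<in> [0,1]\<close> of a point of \<open>[0,1]\<close> lies in \<open>[0,2]\<close>, so the peaks
  at \<open>0, 1, 2\<close> suffice.
\<close>

definition tent_zone :: "real \<Rightarrow> real \<Rightarrow> real set" where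
  "tent_zone d s = (\<Union>n<3. {real n - d/2 .. real n + d/2} \<union> {real n - s - d/2 .. real n - s + d/2})"

lemma tent_eq_0:
  assumes "0 < d" "d \<le> 1" "0 \<le> x" "x \<le> 2"
      and "\<And>n. n < 3 \<Longrightarrow> x \<notin> {real n - d/2 .. real n + d/2}"
  shows "tent d x = 0"
proof (rule ccontr)
  assume "tent d x \<noteq> 0"
  then have lt: "2 * infdist x \<int> < d"
    using assms(1) by (auto simp: tent_def max_def field_simps split: if_splits)
  obtain k :: int where "infdist x \<int> = \<bar>x - of_int k\<bar>" by (rule infdist_Ints_attained)
  with lt have *: "2 * \<bar>x - of_int k\<bar> < d" by simp
  then have "real_of_int (-1) < of_int k" "of_int k < real_of_int 3"
    using assms(2-4) by (auto simp: abs_if split: if_splits)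
  then have "k > -1" "k < 3" unfolding of_int_less_iff by auto
  then have "nat k < 3" "real (nat k) = of_int k" by auto
  with assms(5)[of "nat k"] * show False by (auto simp: abs_if split: if_splits)
qed

lemma tent_increment_eq_0:
  assumes "0 < d" "d \<le> 1" "0 \<le> s" "s \<le> 1" "0 \<le> x" "x \<le> 1" "x \<notin> tent_zone d s"
  shows "tent d (x + s) - tent d x = 0"
proof -
  have "tent d x = 0" using assms by (intro tent_eq_0) (auto simp: tent_zone_def)
  moreover have "tent d (x + s) = 0" 
    using assms by (intro tent_eq_0) (auto simp: tent_zone_def algebra_simps)
  ultimately show ?thesis by simp
qed

lemma tent_zone_sets: "tent_zone d s \<in> sets borel"
  by (simp add: tent_zone_def)

lemma emeasure_tent_zone:
  assumes "0 < d" shows "emeasure lborel (tent_zone d s) \<le> ennreal (6 * d)"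
proof -
  have "emeasure lborel (tent_zone d s) \<le> (\<Sum>n<3. emeasure lborel ({real n - d/2 .. real n + d/2} \<union> {real n - s - d/2 .. real n - s + d/2}))"
    unfolding tent_zone_def by (intro emeasure_subadditive_finite) auto
  also have "\<dots> \<le> (\<Sum>n\<in>{..<3::nat}. ennreal (2 * d))"
  proof (intro sum_mono)
    fix n :: nat
    have "emeasure lborel ({real n - d/2 .. real n + d/2} \<union> {real n - s - d/2 .. real n - s + d/2})
      \<le> emeasure lborel {real n - d/2 .. real n + d/2} + emeasure lborel {real n - s - d/2 .. real n - s + d/2}"
      by (intro emeasure_subadditive) auto
    also have "\<dots> = ennreal (2 * d)"
      using assms by (simp flip: ennreal_plus)
    finally show "emeasure lborel ({real n - d/2 .. real n + d/2} \<union> {real n - s - d/2 .. real n - s + d/2}) \<le> ennreal (2 * d)" .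
  qed
  also have "\<dots> = ennreal 3 * ennreal (2 * d)" by simp
  also have "\<dots> = ennreal (6 * d)"
    using assms by (subst ennreal_mult[symmetric]) auto
  finally show ?thesis .
qed

section \<open>Mixed moduli of products of tents\<close>

lemma ennreal_proot_le:
  assumes "p > 0" "a \<le> ennreal r" "0 \<le> r"
  shows "ennreal_proot p a \<le> ennreal (r powr (1 / p))"
proof -
  have "a \<noteq> \<infinity>" using assms(2) by (auto simp: top_unique)
  moreover have "enn2real a \<le> r" using assms by (intro enn2real_leI) auto
  ultimately show ?thesis
    using assms by (auto simp: ennreal_proot_def intro!: ennreal_leI powr_mono2)
qed

text \<open>
  A crude bound by height times the \<open>p\<close>-th root of the measure of a rectangle; for tents it
  loses only a constant factor and spares the computation of any integral over the square.
\<close>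

lemma Lp_norm_le_of_support:
  assumes p: "p > 0" and M: "M \<ge> 0" and r: "r \<ge> 0" "r' \<ge> 0"
    and X: "X \<in> sets lborel" "emeasure lborel X \<le> ennreal r"
    and Y: "Y \<in> sets lborel" "emeasure lborel Y \<le> ennreal r'"
    and F: "\<And>x y. x \<in> {0..1} \<Longrightarrow> y \<in> {0..1} \<Longrightarrow> \<bar>F (x, y)\<bar> \<le> M * indicator (X \<times> Y) (x, y)"
  shows "Lp_norm p F \<le> ennreal (M * (r * r') powr (1 / p))"
proof -
  have "(\<integral>\<^sup>+ z \<in> {0..1} \<times> {0..1}. ennreal (\<bar>F z\<bar> powr p) \<partial>lebesgue)
      \<le> (\<integral>\<^sup>+ z. ennreal (M powr p) * indicator (X \<times> Y) z \<partial>lebesgue)"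
  proof (intro nn_integral_mono)
    fix z :: "real \<times> real"
    obtain x y where z: "z = (x, y)" by force
    show "ennreal (\<bar>F z\<bar> powr p) * indicator ({0..1} \<times> {0..1}) z
        \<le> ennreal (M powr p) * indicator (X \<times> Y) z"
    proof (cases "z \<in> {0..1} \<times> {0..1}")
      case True
      then have *: "\<bar>F z\<bar> \<le> M * indicator (X \<times> Y) z" using F z by auto
      show ?thesis
      proof (cases "z \<in> X \<times> Y")
        case T: True
        with * have "\<bar>F z\<bar> \<le> M" by simp
        then have "\<bar>F z\<bar> powr p \<le> M powr p" using p by (intro powr_mono2) auto
        then show ?thesis using True T by (simp add: ennreal_leI)
      next
        case False
        with * have "F z = 0" by simp
        then show ?thesis by simp
      qed
    qed simp
  qed
  also have "\<dots> = ennreal (M powr p) * emeasure lborel (X \<times> Y)"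
  proof -
    have "X \<times> Y \<in> sets (lborel \<Otimes>\<^sub>M lborel)" using X Y by (intro pair_measureI)
    then have "X \<times> Y \<in> sets (lborel :: (real \<times> real) measure)" by (simp only: lborel_prod)
    then show ?thesis by (simp add: nn_integral_completion nn_integral_cmult_indicator)
  qed
  also have "emeasure lborel (X \<times> Y) = emeasure lborel X * emeasure lborel Y"
    unfolding lborel_prod[symmetric] using X Y by (intro lborel.emeasure_pair_measure_Times)
  also have "ennreal (M powr p) * (emeasure lborel X * emeasure lborel Y)
      \<le> ennreal (M powr p) * (ennreal r * ennreal r')"
    using X Y by (intro mult_left_mono mult_mono) auto
  also have "\<dots> = ennreal (M powr p * (r * r'))"
    using r by (simp add: ennreal_mult)
  finally have "Lp_norm p F \<le> ennreal ((M powr p * (r * r')) powr (1 / p))"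
    unfolding Lp_norm_def using p r by (intro ennreal_proot_le) auto
  also have "(M powr p * (r * r')) powr (1 / p) = M * (r * r') powr (1 / p)"
    using p M r by (simp add: powr_mult powr_powr)
  finally show ?thesis .
qed

definition tent2 :: "real \<Rightarrow> real \<Rightarrow> real \<times> real \<Rightarrow> real" where
  "tent2 d e = (\<lambda>(x, y). tent d x * tent e y)"

text \<open>
  Up to a constant, the modulus of continuity in \<open>L\<^sup>p\<close> of the tent whose base has length
  \<open>a\<^sup>p\<close>. Measuring the base by its \<open>p\<close>-th root \<open>a\<close> is what makes the final estimates
  depend on \<open>p\<close> only through polynomials.
\<close>

definition tent_modulus :: "real \<Rightarrow> real \<Rightarrow> real \<Rightarrow> real" where
  "tent_modulus p a t = a * min 1 (t / a powr p)"

lemma mixed_diff_tent2: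
  "mixed_diff s t (tent2 d e) (x, y) = (tent d (x + s) - tent d x) * (tent e (y + t) - tent e y)"
  by (simp add: mixed_diff_def tent2_def algebra_simps)

lemma tent_modulus_nonneg: "0 \<le> a \<Longrightarrow> 0 \<le> t \<Longrightarrow> 0 \<le> tent_modulus p a t"
  by (simp add: tent_modulus_def)

lemma tent_modulus_mono: "0 \<le> a \<Longrightarrow> s \<le> t \<Longrightarrow> tent_modulus p a s \<le> tent_modulus p a t"
  unfolding tent_modulus_def by (intro mult_left_mono min.mono divide_right_mono) auto

lemma tent_modulus_1: "0 < a \<Longrightarrow> a \<le> 1 \<Longrightarrow> p > 0 \<Longrightarrow> tent_modulus p a 1 = a"
  using powr_mono2[of p a 1] by (simp add: tent_modulus_def min_def field_simps)

text \<open>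
  The constant is \<open>2 \<cdot> 2\<close> from the heights of the two increments, times
  \<open>(6 \<cdot> 6)\<^bsup>1/p\<^esup> \<le> 36\<close> from the measures of the two supporting sets.
\<close>

lemma mixed_modulus_tent2_le:
  assumes p: "p \<ge> 1" and a: "0 < a" "a \<le> 1" and b: "0 < b" "b \<le> 1"
    and u: "u \<le> 1" and v: "v \<le> 1"
  shows "mixed_modulus p (tent2 (a powr p) (b powr p)) u v
           \<le> ennreal (144 * (tent_modulus p a u * tent_modulus p b v))"
  unfolding mixed_modulus_def
proof (intro SUP_least)
  fix s t assume s: "s \<in> {0..u}" and t: "t \<in> {0..v}"
  define d e where "d = a powr p" and "e = b powr p"
  have d: "0 < d" "d \<le> 1" and e: "0 < e" "e \<le> 1"
    using a b p powr_mono2[of p a 1] powr_mono2[of p b 1] by (auto simp: d_def e_def)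
  define M where "M = (2 * min 1 (s / d)) * (2 * min 1 (t / e))"
  have "Lp_norm p (mixed_diff s t (tent2 d e)) \<le> ennreal (M * ((6 * d) * (6 * e)) powr (1 / p))"
  proof (rule Lp_norm_le_of_support)
    show "M \<ge> 0" using s t d e by (simp add: M_def)
    fix x y :: real assume xy: "x \<in> {0..1}" "y \<in> {0..1}"
    show "\<bar>mixed_diff s t (tent2 d e) (x, y)\<bar>
        \<le> M * indicator (tent_zone d s \<times> tent_zone e t) (x, y)"
    proof (cases "x \<in> tent_zone d s \<and> y \<in> tent_zone e t")
      case True
      have "\<bar>mixed_diff s t (tent2 d e) (x, y)\<bar> \<le> M"
        unfolding mixed_diff_tent2 abs_mult M_def using s t d e
        by (intro mult_mono tent_increment_le) auto
      then show ?thesis using True by simp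
    next
      case False
      then have "tent d (x + s) - tent d x = 0 \<or> tent e (y + t) - tent e y = 0"
        using tent_increment_eq_0[of d s x] tent_increment_eq_0[of e t y] xy s t u v d e by auto
      then show ?thesis using False by (auto simp: mixed_diff_tent2)
    qed
  qed (use p d e in \<open>auto intro: emeasure_tent_zone simp: tent_zone_sets\<close>)
  also have "M * ((6 * d) * (6 * e)) powr (1 / p)
      = 4 * 36 powr (1 / p) * (tent_modulus p a s * tent_modulus p b t)"
    using p a b by (simp add: M_def d_def e_def tent_modulus_def powr_mult powr_powr)
  also have "\<dots> \<le> 144 * (tent_modulus p a u * tent_modulus p b v)"
  proof (intro mult_mono)
    have "36 powr (1 / p) \<le> 36 powr (1::real)" using p by (intro powr_mono) auto
    then show "4 * 36 powr (1 / p) \<le> (144::real)" by simp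
  qed (use s t a b in \<open>auto intro!: tent_modulus_mono tent_modulus_nonneg mult_nonneg_nonneg\<close>)
  finally show "Lp_norm p (mixed_diff s t (tent2 (a powr p) (b powr p)))
      \<le> ennreal (144 * (tent_modulus p a u * tent_modulus p b v))"
    by (simp add: ennreal_leI d_def e_def)
qed

section \<open>The functionals \<open>K\<^sub>p\<close> and \<open>I\<^sub>p\<close> for products of tents\<close>

definition weighted_int :: "real \<Rightarrow> (real \<Rightarrow> real) \<Rightarrow> ennreal" where
  "weighted_int p w = (\<integral>\<^sup>+ t \<in> {0<..<1}. ennreal (t powr (- 1 / p) / t * w t) \<partial>lborel)"

text \<open>
  Below \<open>d = a\<^sup>p\<close> the integrand is \<open>(a/d) t\<^bsup>-1/p\<^esup>\<close>, with integral
  \<open>1/(1 - 1/p) \<le> 2\<close>. Above \<open>d\<close> it is \<open>a t\<^bsup>-1/p-1\<^esup>\<close>, with integral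
  \<open>ap(1/a - 1) = p(1 - a)\<close>, which vanishes for \<open>a = 1\<close>.
\<close>

lemma weighted_int_tent_modulus_le:
  assumes p: "p \<ge> 2" and a: "0 < a" "a \<le> 1"
  shows "weighted_int p (tent_modulus p a) \<le> ennreal (2 + p * (1 - a))"
proof -
  define d where "d = a powr p"
  have d: "0 < d" "d \<le> 1"
    using a p powr_mono2[of p a 1] by (auto simp: d_def)
  have da: "d powr (1 / p) = a" using a p by (simp add: d_def powr_powr)
  have dm: "d powr (- 1 / p) = 1 / a"
  proof -
    have "d powr (- 1 / p) = d powr (- (1 / p))" by simp
    also have "\<dots> = inverse (d powr (1 / p))" by (rule powr_minus)
    finally show ?thesis by (simp add: da inverse_eq_divide)
  qed
  define G where "G = (\<lambda>t. a / d * (t powr (- 1 / p)))"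
  define H where "H = (\<lambda>t. a * (t powr (- 1 / p - 1)))"
  have G: "(\<integral>\<^sup>+ t \<in> {0..d}. ennreal (G t) \<partial>lborel) = ennreal (1 / (1 - 1 / p))"
  proof -
    have "((\<lambda>t. t powr (- 1 / p)) has_integral (d powr (- 1 / p + 1) / (- 1 / p + 1))) {0..d}"
      using p d by (intro has_integral_powr_from_0) (auto simp: field_simps)
    then have "(G has_integral (a / d * (d powr (- 1 / p + 1) / (- 1 / p + 1)))) {0..d}"
      unfolding G_def by (rule has_integral_mult_right)
    also have "d powr (- 1 / p + 1) = d / a"
      unfolding powr_add dm using d by simp
    also have "- 1 / p + 1 = 1 - 1 / p" by simp
    also have "a / d * (d / a / (1 - 1 / p)) = 1 / (1 - 1 / p)"
    proof -
      have "a / d * (d / a / c) = 1 / c" for c using a d by (cases "c = 0") (auto simp: field_simps)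
      then show ?thesis .
    qed
    finally show ?thesis
      using a d by (intro nn_integral_has_integral_lebesgue') (auto simp: G_def)
  qed
  have H: "(\<integral>\<^sup>+ t \<in> {d..1}. ennreal (H t) \<partial>lborel) = ennreal (p * (1 - a))"
  proof -
    have "(H has_integral ((- a * p * 1 powr (- 1 / p)) - (- a * p * d powr (- 1 / p)))) {d..1}"
    proof (rule fundamental_theorem_of_calculus)
      fix t assume "t \<in> {d..1}"
      then have t: "t > 0" using d by auto
      have "((\<lambda>t. - a * p * t powr (- 1 / p)) has_real_derivative H t) (at t)"
        unfolding H_def using p t by (auto intro!: derivative_eq_intros)
      then show "((\<lambda>t. - a * p * t powr (- 1 / p)) has_vector_derivative H t) (at t within {d..1})"
        by (simp add: has_real_derivative_iff_has_vector_derivative has_vector_derivative_at_within)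
    qed (use d in auto)
    also have "d powr (- 1 / p) = 1 / a"
      by (rule dm)
    also have "(- a * p * 1 powr (- 1 / p)) - (- a * p * (1 / a)) = p * (1 - a)"
      using a by (simp add: algebra_simps)
    finally show ?thesis
      using a d by (intro nn_integral_has_integral_lebesgue') (auto simp: H_def)
  qed
  have [measurable]: "G \<in> borel_measurable borel" "H \<in> borel_measurable borel"
    unfolding G_def H_def by measurable
  have "weighted_int p (tent_modulus p a)
      \<le> (\<integral>\<^sup>+ t. ennreal (G t) * indicator {0..d} t + ennreal (H t) * indicator {d..1} t \<partial>lborel)"
    unfolding weighted_int_def
  proof (intro nn_integral_mono)
    fix t :: real
    show "ennreal (t powr (- 1 / p) / t * tent_modulus p a t) * indicator {0<..<1} t
        \<le> ennreal (G t) * indicator {0..d} t + ennreal (H t) * indicator {d..1} t"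
    proof (cases "t \<in> {0<..<1}")
      case True
      then have t: "0 < t" "t < 1" by auto
      show ?thesis
      proof (cases "t \<le> d")
        case True
        have "t powr (- 1 / p) / t * tent_modulus p a t \<le> t powr (- 1 / p) / t * (a * (t / d))"
          unfolding tent_modulus_def d_def using t a by (intro mult_left_mono) auto
        also have "\<dots> = G t" using t by (simp add: G_def)
        finally show ?thesis using t True by (auto simp: indicator_def intro: ennreal_leI add_increasing2)
      next
        case False
        have "t powr (- 1 / p) / t * tent_modulus p a t \<le> t powr (- 1 / p) / t * (a * 1)"
          unfolding tent_modulus_def using t a by (intro mult_left_mono) auto
        also have "\<dots> = H t" using t by (simp add: H_def powr_diff)
        finally show ?thesis using t False by (auto simp: indicator_def intro: ennreal_leI)
      qed
    qed simp
  qed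
  also have "\<dots> = ennreal (1 / (1 - 1 / p)) + ennreal (p * (1 - a))"
    by (subst nn_integral_add) (auto simp: G H)
  also have "\<dots> \<le> ennreal (2 + p * (1 - a))"
  proof -
    have "1 / (1 - 1 / p) \<le> 2" using p by (simp add: field_simps)
    then have "ennreal (1 / (1 - 1 / p)) + ennreal (p * (1 - a)) \<le> ennreal 2 + ennreal (p * (1 - a))"
      by (intro add_right_mono ennreal_leI)
    also have "\<dots> = ennreal (2 + p * (1 - a))"
      using p a by (intro ennreal_plus[symmetric]) auto
    finally show ?thesis .
  qed
  finally show ?thesis .
qed

lemma tent_modulus_measurable [measurable]: "tent_modulus p a \<in> borel_measurable borel"
  unfolding tent_modulus_def[abs_def] by measurable

lemma K_fun_tent2_le:
  assumes p: "p \<ge> 2" and a: "0 < a" "a \<le> 1" and b: "0 < b" "b \<le> 1"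
  shows "K_fun p (tent2 (a powr p) (b powr p))
    \<le> ennreal (144 * ((2 + p * (1 - a)) * b + a * (2 + p * (1 - b))))"
proof -
  let ?f = "tent2 (a powr p) (b powr p)"
  define k where "k = (\<lambda>a t. ennreal (t powr (- 1 / p) / t * tent_modulus p a t) * indicator {0<..<1} t)"
  have k: "(\<integral>\<^sup>+ t. k a t \<partial>lborel) = weighted_int p (tent_modulus p a)" for a
    by (simp add: k_def weighted_int_def)
  have [measurable]: "k a \<in> borel_measurable borel" for a unfolding k_def by measurable
  have "K_fun p ?f \<le> (\<integral>\<^sup>+ t. ennreal (144 * b) * k a t + ennreal (144 * a) * k b t \<partial>lborel)"
    unfolding K_fun_def
  proof (intro nn_integral_mono)
    fix t :: real
    show "ennreal (t powr (- 1 / p) / t) * (mixed_modulus p ?f t 1 + mixed_modulus p ?f 1 t)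
          * indicator {0<..<1} t \<le> ennreal (144 * b) * k a t + ennreal (144 * a) * k b t"
    proof (cases "t \<in> {0<..<1}")
      case True
      then have t: "0 < t" "t < 1" by auto
      have nn: "tent_modulus p a t \<ge> 0" "tent_modulus p b t \<ge> 0"
        using a b t by (auto intro: tent_modulus_nonneg)
      have "ennreal (t powr (- 1 / p) / t) * (mixed_modulus p ?f t 1 + mixed_modulus p ?f 1 t)
        \<le> ennreal (t powr (- 1 / p) / t) * (ennreal (144 * (tent_modulus p a t * b)) + ennreal (144 * (a * tent_modulus p b t)))"
        using mixed_modulus_tent2_le[of p a b t 1] mixed_modulus_tent2_le[of p a b 1 t] p a b t
        by (intro mult_left_mono add_mono) (auto simp: tent_modulus_1)
      also have "\<dots> = ennreal (144 * b) * k a t + ennreal (144 * a) * k b t"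
        using True t a b nn unfolding k_def
        by (simp add: flip: ennreal_plus ennreal_mult) (simp add: algebra_simps add_divide_distrib)
      finally show ?thesis using True by simp
    qed (simp add: k_def)
  qed
  also have "\<dots> = ennreal (144 * b) * weighted_int p (tent_modulus p a)
      + ennreal (144 * a) * weighted_int p (tent_modulus p b)"
    by (subst nn_integral_add) (auto simp: nn_integral_cmult k)
  also have "\<dots> \<le> ennreal (144 * b) * ennreal (2 + p * (1 - a)) + ennreal (144 * a) * ennreal (2 + p * (1 - b))"
    using p a b by (intro add_mono mult_left_mono weighted_int_tent_modulus_le) auto
  also have "\<dots> = ennreal (144 * ((2 + p * (1 - a)) * b + a * (2 + p * (1 - b))))"
    using p a b by (simp flip: ennreal_plus ennreal_mult)
  finally show ?thesis .
qed

lemma I_fun_tent2_le: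
  assumes p: "p \<ge> 2" and a: "0 < a" "a \<le> 1" and b: "0 < b" "b \<le> 1"
  shows "I_fun p (tent2 (a powr p) (b powr p))
    \<le> ennreal (144 * ((2 + p * (1 - a)) * (2 + p * (1 - b))))"
proof -
  let ?f = "tent2 (a powr p) (b powr p)"
  define k where "k = (\<lambda>a t. ennreal (t powr (- 1 / p) / t * tent_modulus p a t) * indicator {0<..<1} t)"
  have k: "(\<integral>\<^sup>+ t. k a t \<partial>lborel) = weighted_int p (tent_modulus p a)" for a
    by (simp add: k_def weighted_int_def)
  have [measurable]: "k a \<in> borel_measurable borel" for a unfolding k_def by measurable
  have "I_fun p ?f \<le> (\<integral>\<^sup>+ v. (\<integral>\<^sup>+ u. (144 * k b v) * k a u \<partial>lborel) \<partial>lborel)"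
    unfolding I_fun_def
  proof (intro nn_integral_mono)
    fix v :: real
    show "(\<integral>\<^sup>+ u \<in> {0<..<1}. ennreal ((u * v) powr (- 1 / p) / (u * v)) * mixed_modulus p ?f u v \<partial>lborel)
        * indicator {0<..<1} v \<le> (\<integral>\<^sup>+ u. (144 * k b v) * k a u \<partial>lborel)"
    proof (cases "v \<in> {0<..<1}")
      case True
      then have v: "0 < v" "v < 1" by auto
      have "(\<integral>\<^sup>+ u \<in> {0<..<1}. ennreal ((u * v) powr (- 1 / p) / (u * v)) * mixed_modulus p ?f u v \<partial>lborel)
        \<le> (\<integral>\<^sup>+ u. (144 * k b v) * k a u \<partial>lborel)"
      proof (intro nn_integral_mono)
        fix u :: real
        show "ennreal ((u * v) powr (- 1 / p) / (u * v)) * mixed_modulus p ?f u v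
             * indicator {0<..<1} u \<le> (144 * k b v) * k a u"
        proof (cases "u \<in> {0<..<1}")
          case True': True
          then have u: "0 < u" "u < 1" by auto
          have nn: "tent_modulus p a u \<ge> 0" "tent_modulus p b v \<ge> 0"
            using a b u v by (auto intro: tent_modulus_nonneg)
          have "ennreal ((u * v) powr (- 1 / p) / (u * v)) * mixed_modulus p ?f u v
            \<le> ennreal ((u * v) powr (- 1 / p) / (u * v)) * ennreal (144 * (tent_modulus p a u * tent_modulus p b v))"
            using p a b u v by (intro mult_left_mono mixed_modulus_tent2_le) auto
          also have "\<dots> = ennreal (((u * v) powr (- 1 / p) / (u * v)) * (144 * (tent_modulus p a u * tent_modulus p b v)))"
            using u v nn by (intro ennreal_mult[symmetric]) auto
          also have "((u * v) powr (- 1 / p) / (u * v)) * (144 * (tent_modulus p a u * tent_modulus p b v))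
             = 144 * ((v powr (- 1 / p) / v * tent_modulus p b v) * (u powr (- 1 / p) / u * tent_modulus p a u))"
            using u v by (simp add: powr_mult mult_ac)
          also have "ennreal \<dots> = 144 * (ennreal (v powr (- 1 / p) / v * tent_modulus p b v)
               * ennreal (u powr (- 1 / p) / u * tent_modulus p a u))"
            using u v nn by (subst ennreal_mult, simp, simp, subst ennreal_mult) auto
          finally show ?thesis using True True' by (simp add: k_def mult.assoc)
        qed (simp add: k_def)
      qed
      then show ?thesis using True by simp
    qed simp
  qed
  also have "\<dots> = 144 * (weighted_int p (tent_modulus p a) * weighted_int p (tent_modulus p b))"
    by (simp add: nn_integral_cmult nn_integral_multc k mult_ac)
  also have "\<dots> \<le> 144 * (ennreal (2 + p * (1 - a)) * ennreal (2 + p * (1 - b)))"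
    using p a b by (intro mult_mono mult_left_mono weighted_int_tent_modulus_le) auto
  also have "\<dots> = ennreal (144 * ((2 + p * (1 - a)) * (2 + p * (1 - b))))"
    using p a b by (simp add: ennreal_mult)
  finally show ?thesis .
qed

section \<open>The lower bound for the variation and its consequences\<close>

lemma continuous_on_tent2: "continuous_on UNIV (tent2 d e)"
  unfolding tent2_def case_prod_beta
  by (intro continuous_intros continuous_on_tent)

lemma tent2_in_Lp_class:
  assumes "p > 0" "0 < d" "0 < e"
  shows "tent2 d e \<in> Lp_class p"
proof -
  have "tent2 d e \<in> borel_measurable borel"
    by (intro borel_measurable_continuous_onI continuous_on_tent2)
  then have "tent2 d e \<in> borel_measurable lebesgue"
    by (intro measurable_completion) auto
  moreover have "periodic1 (tent2 d e)"
    by (simp add: periodic1_def tent2_def tent_add_1)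
  moreover have "Lp_norm p (tent2 d e) \<le> ennreal (1 * (1 * 1) powr (1 / p))"
    by (rule Lp_norm_le_of_support[where X = "{0..1}" and Y = "{0..1}"])
       (use assms in \<open>auto simp: tent2_def abs_mult tent_bounds intro!: mult_le_one\<close>)
  then have "Lp_norm p (tent2 d e) < \<infinity>"
    by (rule le_less_trans) auto
  ultimately show ?thesis by (simp add: Lp_class_def)
qed

text \<open>
  Each tent is 1 at the integers and 0 at the half-integers, so all four mixed differences over
  the net with axes \<open>0, 1/2, 1\<close> are \<open>1\<close> or \<open>-1\<close>.
\<close>

lemma vp2_tent2_ge_1:
  assumes "p > 0" "0 < d" "d \<le> 1" "0 < e" "e \<le> 1"
  shows "vp2 p (tent2 d e) \<ge> 1"
proof -
  define x :: "nat \<Rightarrow> real" where "x = (\<lambda>i. real i / 2)"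
  have part: "partition1 2 x" by (auto simp: partition1_def x_def)
  let ?S = "(\<Sum>i<2. \<Sum>j<2. \<bar>tent2 d e (x (Suc i), x (Suc j)) - tent2 d e (x (Suc i), x j)
      - tent2 d e (x i, x (Suc j)) + tent2 d e (x i, x j)\<bar> powr p)"
  have "?S = (4::real)"
    using assms by (simp add: numeral_2_eq_2 lessThan_Suc x_def tent2_def tent_0 tent_1 tent_half)
  then have "ennreal (?S powr (1 / p)) \<ge> 1"
    using assms by (simp add: ge_one_powr_ge_zero)
  moreover have "ennreal (?S powr (1 / p)) \<le> vp2 p (tent2 d e)"
    unfolding vp2_def using part by (intro Sup_upper) blast
  ultimately show ?thesis by (rule order_trans)
qed

text \<open>
  The coefficient \<open>\<gamma>\<close> of the modulus term is \<open>0\<close> for the first part of the theorem and \<open>1\<close> for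
  the second. Every conclusion below is read off from this inequality between real numbers by a
  choice of \<open>a\<close> and \<open>b\<close>.
\<close>

lemma tent2_estimate:
  assumes p: "p \<ge> 2" and a: "0 < a" "a \<le> 1" and b: "0 < b" "b \<le> 1"
    and nonneg: "A \<ge> 0" "\<gamma> \<ge> 0" "\<alpha> \<ge> 0" "\<beta> \<ge> 0"
    and bound: "\<And>f. f \<in> Lp_class p \<Longrightarrow> continuous_on UNIV f \<Longrightarrow> I_fun p f < \<infinity> \<Longrightarrow>
       vp2 p f \<le> ennreal A * (ennreal \<gamma> * mixed_modulus p f 1 1 + ennreal \<alpha> * K_fun p f + ennreal \<beta> * I_fun p f)"
  shows "1 \<le> 144 * A * (\<gamma> * (a * b) + \<alpha> * ((2 + p * (1 - a)) * b + a * (2 + p * (1 - b)))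
             + \<beta> * ((2 + p * (1 - a)) * (2 + p * (1 - b))))"
proof -
  let ?f = "tent2 (a powr p) (b powr p)"
  define k l where "k = 2 + p * (1 - a)" and "l = 2 + p * (1 - b)"
  have kl: "k \<ge> 0" "l \<ge> 0" using p a b by (simp_all add: k_def l_def)
  have ap: "0 < a powr p" "a powr p \<le> 1" "0 < b powr p" "b powr p \<le> 1"
    using a b p powr_mono2[of p a 1] powr_mono2[of p b 1] by auto
  have M: "mixed_modulus p ?f 1 1 \<le> ennreal (144 * (a * b))"
    using mixed_modulus_tent2_le[of p a b 1 1] p a b by (simp add: tent_modulus_1)
  have K: "K_fun p ?f \<le> ennreal (144 * (k * b + a * l))"
    using K_fun_tent2_le[OF p a b] by (simp add: k_def l_def)
  have I: "I_fun p ?f \<le> ennreal (144 * (k * l))"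
    using I_fun_tent2_le[OF p a b] by (simp add: k_def l_def)
  have "1 \<le> vp2 p ?f" using p ap by (intro vp2_tent2_ge_1) auto
  also have "\<dots> \<le> ennreal A * (ennreal \<gamma> * mixed_modulus p ?f 1 1 + ennreal \<alpha> * K_fun p ?f + ennreal \<beta> * I_fun p ?f)"
    using p ap I by (intro bound tent2_in_Lp_class continuous_on_tent2) (auto intro: le_less_trans)
  also have "\<dots> \<le> ennreal A * (ennreal \<gamma> * ennreal (144 * (a * b)) + ennreal \<alpha> * ennreal (144 * (k * b + a * l))
      + ennreal \<beta> * ennreal (144 * (k * l)))"
    by (intro mult_left_mono add_mono M K I) auto
  also have "\<dots> = ennreal (A * (\<gamma> * (144 * (a * b)) + \<alpha> * (144 * (k * b + a * l)) + \<beta> * (144 * (k * l))))"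
    using nonneg kl a b by (simp flip: ennreal_plus ennreal_mult)
  finally have "1 \<le> A * (\<gamma> * (144 * (a * b)) + \<alpha> * (144 * (k * b + a * l)) + \<beta> * (144 * (k * l)))"
    by simp
  then show ?thesis by (simp add: k_def l_def algebra_simps)
qed

lemma Liminf_at_top_pos:
  fixes g :: "real \<Rightarrow> real"
  assumes "c > 0" "\<And>p. p \<ge> P \<Longrightarrow> c \<le> g p"
  shows "Liminf at_top (\<lambda>p. ereal (g p)) > 0"
proof -
  have "ereal c \<le> Liminf at_top (\<lambda>p. ereal (g p))"
    using assms(2) by (intro Liminf_bounded) (auto simp: eventually_at_top_linorder)
  then show ?thesis using assms(1) by (meson ereal_less(2) less_le_trans)
qed

theorem mainTheorem8:
  shows
    "(\<not> (\<exists>A::real. A > 0 \<and>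
        (\<forall>p::real. p > 2 \<longrightarrow>
          (\<forall>f. f \<in> Lp_class p \<and> continuous_on UNIV f \<and> I_fun p f < \<infinity> \<longrightarrow>
            vp2 p f \<le> ennreal A *
              (ennreal (1 / p) * K_fun p f + ennreal (1 / p\<^sup>2) * I_fun p f)))))
   \<and>
    (\<forall>(\<alpha> :: real \<Rightarrow> real) (\<beta> :: real \<Rightarrow> real).
        (\<forall>p>1. 0 \<le> \<alpha> p \<and> \<alpha> p \<le> 1 / p \<and> 0 \<le> \<beta> p \<and> \<beta> p \<le> 1 / p\<^sup>2) \<and>
        (\<exists>A::real. A > 0 \<and>
          (\<forall>p::real. p > 1 \<longrightarrow>
            (\<forall>f. f \<in> Lp_class p \<and> continuous_on UNIV f \<and> I_fun p f < \<infinity> \<longrightarrow>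
              vp2 p f \<le> ennreal A *
                (mixed_modulus p f 1 1 + ennreal (\<alpha> p) * K_fun p f + ennreal (\<beta> p) * I_fun p f))))
        \<longrightarrow>
        Liminf at_top (\<lambda>p. ereal (p * \<alpha> p)) > 0 \<and>
        Liminf at_top (\<lambda>p. ereal (p\<^sup>2 * \<beta> p)) > 0)"
proof (intro conjI notI allI impI; (elim conjE exE)?)
  fix A :: real
  assume A: "A > 0" and bound: "\<forall>p::real. p > 2 \<longrightarrow>
          (\<forall>f. f \<in> Lp_class p \<and> continuous_on UNIV f \<and> I_fun p f < \<infinity> \<longrightarrow>
            vp2 p f \<le> ennreal A *
              (ennreal (1 / p) * K_fun p f + ennreal (1 / p\<^sup>2) * I_fun p f))"
  (* with a = b = 1 the right-hand side is at most 144 A (4/p + 4/p) = 1152 A / p *)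
  define p where "p = 1152 * A + 3"
  have p: "p > 2" using A by (simp add: p_def)
  have "1 \<le> 144 * A * (0 * (1 * 1) + 1 / p * ((2 + p * (1 - 1)) * 1 + 1 * (2 + p * (1 - 1)))
             + 1 / p\<^sup>2 * ((2 + p * (1 - 1)) * (2 + p * (1 - 1))))"
    by (rule tent2_estimate) (use p A bound in auto)
  also have "\<dots> = 144 * A * (4 / p + 4 / p\<^sup>2)" by simp
  also have "\<dots> \<le> 144 * A * (4 / p + 4 / p)"
    using p A by (intro mult_left_mono add_left_mono divide_left_mono) (auto simp: power2_eq_square)
  also have "\<dots> = 1152 * A / p" by simp
  also have "\<dots> < 1" using p by (subst divide_less_eq_1_pos) (auto simp: p_def)
  finally show False by simp
next
  fix \<alpha> \<beta> :: "real \<Rightarrow> real" and A :: real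
  assume ab: "\<forall>p>1. 0 \<le> \<alpha> p \<and> \<alpha> p \<le> 1 / p \<and> 0 \<le> \<beta> p \<and> \<beta> p \<le> 1 / p\<^sup>2"
    and A: "A > 0" and bound: "\<forall>p::real. p > 1 \<longrightarrow>
            (\<forall>f. f \<in> Lp_class p \<and> continuous_on UNIV f \<and> I_fun p f < \<infinity> \<longrightarrow>
              vp2 p f \<le> ennreal A *
                (mixed_modulus p f 1 1 + ennreal (\<alpha> p) * K_fun p f + ennreal (\<beta> p) * I_fun p f))"
  define C where "C = 144 * A"
  have C: "C > 0" using A by (simp add: C_def)
  have est: "1 \<le> C * (a * b + \<alpha> p * ((2 + p * (1 - a)) * b + a * (2 + p * (1 - b)))
             + \<beta> p * ((2 + p * (1 - a)) * (2 + p * (1 - b))))"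
    if "p \<ge> 2" "0 < a" "a \<le> 1" "0 < b" "b \<le> 1" for p a b
  proof -
    have "1 \<le> 144 * A * (1 * (a * b) + \<alpha> p * ((2 + p * (1 - a)) * b + a * (2 + p * (1 - b)))
             + \<beta> p * ((2 + p * (1 - a)) * (2 + p * (1 - b))))"
      by (rule tent2_estimate) (use that ab A bound in auto)
    then show ?thesis by (simp add: C_def)
  qed
  have k: "2 + p * (1 - a) \<le> 2 * p" "2 + p * (1 - a) \<ge> 0" if "p \<ge> 2" "0 < a" "a \<le> 1" for p a :: real
  proof -
    have "p * (1 - a) \<le> p * 1" using that by (intro mult_left_mono) auto
    then show "2 + p * (1 - a) \<le> 2 * p" using that by linarith
    show "2 + p * (1 - a) \<ge> 0" using that by simp
  qed
  show "Liminf at_top (\<lambda>p. ereal (p * \<alpha> p)) > 0"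
  proof (rule Liminf_at_top_pos)
    (* the terms C a and 4 C / p take at most 1/4 each, leaving 1/2 for the \<alpha>-term *)
    define a where "a = min 1 (1 / (4 * C))"
    have a: "0 < a" "a \<le> 1" "C * a \<le> 1 / 4"
      using C by (auto simp: a_def min_def field_simps)
    fix p assume p: "p \<ge> 2 + 16 * C"
    then have p2: "p \<ge> 2" using C by simp
    have \<alpha>: "0 \<le> \<alpha> p" and \<beta>: "0 \<le> \<beta> p" "\<beta> p \<le> 1 / p\<^sup>2" using ab p2 by auto
    have "1 \<le> C * (a * 1 + \<alpha> p * ((2 + p * (1 - a)) * 1 + a * (2 + p * (1 - 1)))
             + \<beta> p * ((2 + p * (1 - a)) * (2 + p * (1 - 1))))"
      using p2 a by (intro est) auto
    also have "\<dots> \<le> C * (a + \<alpha> p * (2 * p * 1 + 1 * (2 * p)) + 1 / p\<^sup>2 * (2 * p * 2))"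
      using C \<alpha> \<beta> p2 a k[OF p2 a(1,2)]
      by (intro mult_left_mono mult_mono add_mono) auto
    also have "\<dots> = C * a + 4 * C * (p * \<alpha> p) + 4 * C / p"
      using p2 by (simp add: field_simps power2_eq_square)
    also have "4 * C / p \<le> 1 / 4" using p p2 by (simp add: field_simps)
    finally have "1 / 2 \<le> 4 * C * (p * \<alpha> p)" using a by linarith
    then show "1 / (8 * C) \<le> p * \<alpha> p" using C by (simp add: field_simps)
  qed (use C in simp)
  show "Liminf at_top (\<lambda>p. ereal (p\<^sup>2 * \<beta> p)) > 0"
  proof (rule Liminf_at_top_pos)
    (* the modulus term is at most C a and, as p \<alpha> p \<le> 1, the \<alpha>-term at most 4 C a;
       together they take at most 1/2 *)
    define a where "a = min 1 (1 / (10 * C))"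
    have a: "0 < a" "a \<le> 1" "C * a \<le> 1 / 10"
      using C by (auto simp: a_def min_def field_simps)
    fix p :: real assume p2: "p \<ge> 2"
    have \<alpha>: "0 \<le> \<alpha> p" "\<alpha> p \<le> 1 / p" and \<beta>: "0 \<le> \<beta> p" using ab p2 by auto
    have "1 \<le> C * (a * a + \<alpha> p * ((2 + p * (1 - a)) * a + a * (2 + p * (1 - a)))
             + \<beta> p * ((2 + p * (1 - a)) * (2 + p * (1 - a))))"
      using p2 a by (intro est) auto
    also have "\<dots> \<le> C * (a * 1 + 1 / p * (2 * p * a + a * (2 * p)) + \<beta> p * (2 * p * (2 * p)))"
      using C \<alpha> \<beta> p2 a k[OF p2 a(1,2)]
      by (intro mult_left_mono mult_mono add_mono) auto
    also have "\<dots> = 5 * (C * a) + 4 * C * (p\<^sup>2 * \<beta> p)"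
      using p2 by (simp add: field_simps power2_eq_square)
    finally have "1 / 2 \<le> 4 * C * (p\<^sup>2 * \<beta> p)" using a by linarith
    then show "1 / (8 * C) \<le> p\<^sup>2 * \<beta> p" using C by (simp add: field_simps)
  qed (use C in simp)
qed

end
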